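(* Let $X\subseteq\mathbb{R}^n$ be a polyhedral set. Let $$\psi(x)=\max_{1\le i\le k_1}\psi_{1i}(x)-\max_{1\le i\le k_2}\psi_{2i}(x),$$ where each $\psi_{ji}:\mathbb{R}^n\to\mathbb{R}$ is a quadratic function. For an arbitrary tuple $c=(c^i)_{i=1}^{k_1}$ of vectors $c^i\in\mathbb{R}^n$, let $$S_c=\left\{x\in X \;\middle|\; \nabla\psi_{1i}(x)+c^i \text{ is a common vector for all } i\in\mathcal{A}_1(x)\right\},\qquad \mathcal{A}_1(x)=\operatorname{argmax}_{1\le i\le k_1}\psi_{1i}(x).$$ Then the set $\psi\left(S_c\cap\mathcal{D}_{(\psi,X)}\right)$ is finite.
   Context: A polyhedral set is a set of the form $\{x\in\mathbb{R}^n : Ax\le b\}$. A quadratic function is a polynomial of degree at most two (its Hessian may be indefinite or zero). Directional derivative: $\psi'(\bar x;v)=\lim_{\delta\downarrow 0}\frac{\psi(\bar x+\delta v)-\psi(\bar x)}{\delta}$. A point $\bar x\in X$ is a d-stationary point of $\min_{x\in X}\psi(x)$ if $\psi'(\bar x;x-\bar x)\ge 0$ for all $x\in X$; $\mathcal{D}_{(\psi,X)}$ denotes the set of all such points. $\operatorname{argmax}_{1\le i\le k_1}\psi_{1i}(x)$ is the set of indices $i$ attaining the maximum at $x$. *)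

theory Defs
  imports "HOL-Analysis.Analysis"
begin

(* Polynomials of degree at most two. Q need not be symmetric (only its symmetric part
   contributes), semidefinite or nonzero; the Hessian is Q + transpose Q. *)
definition quadratic_function :: "(real ^ 'n \<Rightarrow> real) \<Rightarrow> bool" where
  "quadratic_function f \<longleftrightarrow>
     (\<exists>(Q :: real ^ 'n ^ 'n) (b :: real ^ 'n) (r :: real).
        \<forall>x. f x = x \<bullet> (Q *v x) + b \<bullet> x + r)"

definition gradient :: "(real ^ 'n \<Rightarrow> real) \<Rightarrow> real ^ 'n \<Rightarrow> real ^ 'n" where
  "gradient f x = (THE D. GDERIV f x :> D)"

lemma gradient_eqI:
  assumes "GDERIV f x :> D"
  shows "gradient f x = D"
proof -
  have "E = D" if E: "GDERIV f x :> E" for E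
  proof -
    have "(\<lambda>h. h \<bullet> E) = (\<lambda>h. h \<bullet> D)"
      by (rule has_derivative_unique [OF E [unfolded gderiv_def] assms [unfolded gderiv_def]])
    then have "\<forall>h. h \<bullet> E = h \<bullet> D"
      by (rule fun_eq_iff [THEN iffD1])
    then show "E = D"
      by (rule vector_eq_ldot [THEN iffD1])
  qed
  with assms show ?thesis
    unfolding gradient_def by (rule the_equality)
qed

definition has_directional_derivative ::
    "(real ^ 'n \<Rightarrow> real) \<Rightarrow> real ^ 'n \<Rightarrow> real ^ 'n \<Rightarrow> real \<Rightarrow> bool" where
  "has_directional_derivative f x v d \<longleftrightarrow>
     ((\<lambda>\<delta>. (f (x + \<delta> *\<^sub>R v) - f x) / \<delta>) \<longlongrightarrow> d) (at_right 0)"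

(* The one-sided limit is unique where it exists. Its existence is part of the definition,
   so that no default value of a missing limit can satisfy the inequality; for differences
   of pointwise maxima of finitely many smooth functions it always exists. *)
definition d_stationary_points :: "(real ^ 'n \<Rightarrow> real) \<Rightarrow> (real ^ 'n) set \<Rightarrow> (real ^ 'n) set" where
  "d_stationary_points f X =
     {xbar \<in> X. \<forall>x\<in>X. \<exists>d. has_directional_derivative f xbar (x - xbar) d \<and> d \<ge> 0}"

definition argmax_indices :: "nat \<Rightarrow> (nat \<Rightarrow> real ^ 'n \<Rightarrow> real) \<Rightarrow> real ^ 'n \<Rightarrow> nat set" where
  "argmax_indices k f x = {i. is_arg_max (\<lambda>i. f i x) (\<lambda>i. i \<in> {1..k}) i}"

definition common_gradient_set ::
    "(real ^ 'n) set \<Rightarrow> nat \<Rightarrow> (nat \<Rightarrow> real ^ 'n \<Rightarrow> real) \<Rightarrow> (nat \<Rightarrow> real ^ 'n) \<Rightarrow> (real ^ 'n) set" where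
  "common_gradient_set X k f c =
     {x \<in> X. \<exists>v. \<forall>i \<in> argmax_indices k f x. gradient (f i) x + c i = v}"

end

theory Submission
  imports Defs
begin

text \<open>
  The value of \<open>\<psi>\<close> at a point of the intersection is determined by three finite pieces of data:
  the indices active in the first maximum, the indices active in the second maximum, and the
  constraints of \<open>X\<close> that are not tight. Since there are only finitely many such data, it suffices
  that two points \<open>x\<close> and \<open>y\<close> sharing them have the same value.

  Quadratic functions satisfy the trapezoidal rule: the increment \<open>f y - f x\<close> is the scalar product
  of \<open>y - x\<close> with the mean of the gradients at \<open>x\<close> and \<open>y\<close>. If \<open>i\<close> and \<open>i'\<close> are active in the first
  maximum at both points, then \<open>\<psi>1 i - \<psi>1 i'\<close> vanishes at both, while its gradient is
  \<open>c i' - c i\<close> at both because they belong to the common gradient set. The trapezoidal rule therefore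
  makes \<open>c i' - c i\<close> orthogonal to \<open>y - x\<close>: all active \<open>\<psi>1 i\<close> have the same slope at \<open>x\<close> in the
  direction \<open>y - x\<close>, so that the first maximum behaves like a smooth function along the segment.

  As \<open>x\<close> and \<open>y\<close> have the same tight constraints, \<open>X\<close> also contains points slightly beyond \<open>x\<close> on
  the line from \<open>y\<close>. Stationarity at \<open>x\<close> can thus be used in the directions \<open>y - x\<close> and \<open>x - y\<close>. Any
  active \<open>\<psi>2 j\<close> bounds the second maximum from below, and this forces the slope of
  \<open>\<psi>1 i - \<psi>2 j\<close> at \<open>x\<close> to be nonnegative in both directions, hence zero. The same holds at \<open>y\<close>, and
  the trapezoidal rule gives \<open>\<psi> x = \<psi>1 i x - \<psi>2 j x = \<psi>1 i y - \<psi>2 j y = \<psi> y\<close>.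
\<close>

lemma finite_image_if_factors:
  assumes "finite (g ` S)"
    and "\<And>x y. x \<in> S \<Longrightarrow> y \<in> S \<Longrightarrow> g x = g y \<Longrightarrow> f x = f y"
  shows "finite (f ` S)"
proof -
  have "f x = (f \<circ> inv_into S g) (g x)" if "x \<in> S" for x
    using assms(2)[of x "inv_into S g (g x)"] that
    by (simp add: f_inv_into_f inv_into_into)
  then have "f ` S \<subseteq> (f \<circ> inv_into S g) ` g ` S"
    by blast
  with assms(1) show ?thesis
    by (meson finite_imageI finite_subset)
qed

lemma quadratic_function_gradient:
  fixes f :: "real ^ 'n \<Rightarrow> real"
  assumes "\<And>x. f x = x \<bullet> (Q *v x) + b \<bullet> x + r"
  shows "GDERIV f x :> Q *v x + transpose Q *v x + b"
proof -
  have "((*v) Q has_derivative (*v) Q) (at x)"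
    by (intro bounded_linear_imp_has_derivative matrix_vector_mul_bounded_linear)
  then have "((\<lambda>x. x \<bullet> (Q *v x) + b \<bullet> x + r) has_derivative
      (\<lambda>h. h \<bullet> (Q *v x + transpose Q *v x + b))) (at x)"
    by (auto intro!: derivative_eq_intros
        simp: fun_eq_iff inner_add_right inner_commute[of _ "x v* Q"]
          inner_commute[of b] dot_lmul_matrix)
  then show ?thesis
    unfolding gderiv_def using assms by presburger
qed

lemma quadratic_function_GDERIV:
  assumes "quadratic_function f"
  shows "GDERIV f x :> gradient f x"
proof -
  obtain Q b r where "\<And>x. f x = x \<bullet> (Q *v x) + b \<bullet> x + r"
    using assms unfolding quadratic_function_def by blast
  then have "GDERIV f x :> Q *v x + transpose Q *v x + b"
    by (rule quadratic_function_gradient)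
  then show ?thesis
    using gradient_eqI by metis
qed

text \<open>
  Along a segment the derivative of a quadratic function is affine, so its integral is the mean of
  the derivatives at the two endpoints.
\<close>

lemma quadratic_function_trapezoidal:
  fixes x y :: "real ^ 'n"
  assumes "quadratic_function f"
  shows "2 * (f y - f x) = (y - x) \<bullet> (gradient f x + gradient f y)"
proof -
  obtain Q b r where f: "\<And>x. f x = x \<bullet> (Q *v x) + b \<bullet> x + r"
    using assms unfolding quadratic_function_def by blast
  have adjoint: "u \<bullet> (transpose Q *v w) = w \<bullet> (Q *v u)" for u w
    by (metis dot_lmul_matrix inner_commute transpose_matrix_vector)
  have grad: "gradient f z = Q *v z + transpose Q *v z + b" for z
    using f by (intro gradient_eqI quadratic_function_gradient)
  show ?thesis
    unfolding f grad inner_add_left inner_add_right inner_diff_left inner_diff_right adjoint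
      inner_commute[of b] matrix_vector_mult_diff_distrib
    by simp
qed

lemma gderiv_ray_tendsto:
  fixes f :: "real ^ 'n \<Rightarrow> real"
  assumes "GDERIV f x :> D"
  shows "((\<lambda>\<delta>. (f (x + \<delta> *\<^sub>R v) - f x) / \<delta>) \<longlongrightarrow> v \<bullet> D) (at_right 0)"
proof -
  have "((\<lambda>\<delta>. x + \<delta> *\<^sub>R v) has_derivative (\<lambda>\<delta>. \<delta> *\<^sub>R v)) (at 0)"
    by (auto intro!: derivative_eq_intros)
  moreover have "(f has_derivative (\<lambda>h. h \<bullet> D)) (at (x + 0 *\<^sub>R v))"
    using assms by (simp add: gderiv_def)
  ultimately have "((\<lambda>\<delta>. f (x + \<delta> *\<^sub>R v)) has_derivative (\<lambda>\<delta>. \<delta> *\<^sub>R v \<bullet> D)) (at 0)"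
    by (rule has_derivative_compose)
  then have "((\<lambda>\<delta>. f (x + \<delta> *\<^sub>R v)) has_real_derivative v \<bullet> D) (at 0)"
    by (simp add: has_field_derivative_def mult.commute[of _ "v \<bullet> D"])
  then have "((\<lambda>\<delta>. (f (x + \<delta> *\<^sub>R v) - f x) / \<delta>) \<longlongrightarrow> v \<bullet> D) (at 0)"
    by (simp add: has_field_derivative_iff)
  then show ?thesis
    by (rule filterlim_mono) (auto simp: at_le)
qed

lemma gderiv_ray_continuous:
  fixes f :: "real ^ 'n \<Rightarrow> real"
  assumes "GDERIV f x :> D"
  shows "((\<lambda>\<delta>. f (x + \<delta> *\<^sub>R v)) \<longlongrightarrow> f x) (at_right 0)"
proof -
  have "isCont f x"
    using assms unfolding gderiv_def by (rule has_derivative_continuous)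
  moreover have "((\<lambda>\<delta>. x + \<delta> *\<^sub>R v) \<longlongrightarrow> x + 0 *\<^sub>R v) (at_right (0::real))"
    by (intro tendsto_intros)
  ultimately show ?thesis
    using isCont_tendsto_compose[of x f] by simp
qed

lemma argmax_indices_Max:
  fixes f :: "nat \<Rightarrow> real ^ 'n \<Rightarrow> real"
  shows "argmax_indices k f x = {i \<in> {1..k}. f i x = (MAX i\<in>{1..k}. f i x)}"
proof -
  have "f i x = (MAX i\<in>{1..k}. f i x) \<longleftrightarrow> (\<forall>l\<in>{1..k}. f l x \<le> f i x)" if "i \<in> {1..k}" for i
    using that by (subst eq_commute, subst Max_eq_iff) auto
  then show ?thesis
    by (auto simp: argmax_indices_def is_arg_max_def not_less)
qed

lemma argmax_indices_nonempty:
  fixes f :: "nat \<Rightarrow> real ^ 'n \<Rightarrow> real"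
  assumes "k \<ge> 1"
  shows "argmax_indices k f x \<noteq> {}"
proof -
  have "(MAX i\<in>{1..k}. f i x) \<in> (\<lambda>i. f i x) ` {1..k}"
    using assms by (intro Max_in) auto
  then show ?thesis
    unfolding argmax_indices_Max by auto
qed

text \<open>
  In the difference of two maxima, a single active index of the second one already yields an upper
  bound, since the remaining indices can only decrease the difference. For the first maximum only the
  slopes of the active functions matter, because the others stay strictly below it near \<open>x\<close>.
\<close>

lemma directional_derivative_diff_Max_le:
  fixes f g :: "nat \<Rightarrow> real ^ 'n \<Rightarrow> real"
  assumes k: "k1 \<ge> 1"
    and f: "\<And>i. i \<in> {1..k1} \<Longrightarrow> GDERIV (f i) x :> D i"
    and g: "GDERIV (g j) x :> E"
    and j: "j \<in> argmax_indices k2 g x"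
    and slope: "\<And>i. i \<in> argmax_indices k1 f x \<Longrightarrow> v \<bullet> D i \<le> a"
    and d: "has_directional_derivative
              (\<lambda>x. (MAX i\<in>{1..k1}. f i x) - (MAX i\<in>{1..k2}. g i x)) x v d"
  shows "d \<le> a - v \<bullet> E"
proof (rule field_le_epsilon)
  fix \<epsilon> :: real assume \<epsilon>: "\<epsilon> > 0"
  define F where "F = (\<lambda>x. MAX i\<in>{1..k1}. f i x)"
  define G where "G = (\<lambda>x. MAX i\<in>{1..k2}. g i x)"
  have "\<forall>\<^sub>F \<delta> in at_right 0. f i (x + \<delta> *\<^sub>R v) \<le> F x + \<delta> * (a + \<epsilon>)" if i: "i \<in> {1..k1}" for i
  proof (cases "i \<in> argmax_indices k1 f x")
    case True
    then have Fx: "f i x = F x"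
      by (simp add: argmax_indices_Max F_def)
    have "v \<bullet> D i < a + \<epsilon>"
      using slope[OF True] \<epsilon> by simp
    then have "\<forall>\<^sub>F \<delta> in at_right 0. (f i (x + \<delta> *\<^sub>R v) - f i x) / \<delta> < a + \<epsilon>"
      using gderiv_ray_tendsto[OF f[OF i]] order_tendstoD(2) by blast
    then show ?thesis
      using eventually_at_right_less[of 0]
      by eventually_elim (simp add: Fx field_simps)
  next
    case False
    then have "f i x \<noteq> F x"
      using i by (simp add: argmax_indices_Max F_def)
    moreover have "f i x \<le> F x"
      unfolding F_def using i by (intro Max_ge) auto
    ultimately have "f i x < F x"
      by simp
    moreover have "((\<lambda>\<delta>. f i (x + \<delta> *\<^sub>R v) - \<delta> * (a + \<epsilon>)) \<longlongrightarrow> f i x - 0 * (a + \<epsilon>)) (at_right 0)"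
      by (intro tendsto_intros gderiv_ray_continuous[OF f[OF i]])
    ultimately have "\<forall>\<^sub>F \<delta> in at_right 0. f i (x + \<delta> *\<^sub>R v) - \<delta> * (a + \<epsilon>) < F x"
      using order_tendstoD(2) by fastforce
    then show ?thesis
      by eventually_elim simp
  qed
  then have "\<forall>\<^sub>F \<delta> in at_right 0. \<forall>i\<in>{1..k1}. f i (x + \<delta> *\<^sub>R v) \<le> F x + \<delta> * (a + \<epsilon>)"
    by (simp add: eventually_ball_finite)
  then have ev: "\<forall>\<^sub>F \<delta> in at_right 0. (F (x + \<delta> *\<^sub>R v) - G (x + \<delta> *\<^sub>R v) - (F x - G x)) / \<delta>
      \<le> (a + \<epsilon>) - (g j (x + \<delta> *\<^sub>R v) - g j x) / \<delta>"
    using eventually_at_right_less[of 0]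
  proof eventually_elim
    case (elim \<delta>)
    have "F (x + \<delta> *\<^sub>R v) \<le> F x + \<delta> * (a + \<epsilon>)"
      unfolding F_def[THEN fun_cong, of "x + \<delta> *\<^sub>R v"] using k elim by (subst Max_le_iff) auto
    moreover have "g j (x + \<delta> *\<^sub>R v) \<le> G (x + \<delta> *\<^sub>R v)"
      unfolding G_def using j by (intro Max_ge) (auto simp: argmax_indices_Max)
    moreover have "g j x = G x"
      using j by (simp add: argmax_indices_Max G_def)
    ultimately have "F (x + \<delta> *\<^sub>R v) - G (x + \<delta> *\<^sub>R v) - (F x - G x)
        \<le> \<delta> * (a + \<epsilon>) - (g j (x + \<delta> *\<^sub>R v) - g j x)"
      by linarith
    then have "(F (x + \<delta> *\<^sub>R v) - G (x + \<delta> *\<^sub>R v) - (F x - G x)) / \<delta>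
        \<le> (\<delta> * (a + \<epsilon>) - (g j (x + \<delta> *\<^sub>R v) - g j x)) / \<delta>"
      using elim(2) by (intro divide_right_mono) simp_all
    also have "\<dots> = (a + \<epsilon>) - (g j (x + \<delta> *\<^sub>R v) - g j x) / \<delta>"
      using elim(2) by (subst diff_divide_distrib) simp
    finally show ?case .
  qed
  have "d \<le> (a + \<epsilon>) - v \<bullet> E"
  proof (rule tendsto_le[OF _ _ _ ev])
    show "((\<lambda>\<delta>. (a + \<epsilon>) - (g j (x + \<delta> *\<^sub>R v) - g j x) / \<delta>) \<longlongrightarrow> (a + \<epsilon>) - v \<bullet> E) (at_right 0)"
      by (intro tendsto_intros gderiv_ray_tendsto g)
    show "((\<lambda>\<delta>. (F (x + \<delta> *\<^sub>R v) - G (x + \<delta> *\<^sub>R v) - (F x - G x)) / \<delta>) \<longlongrightarrow> d) (at_right 0)"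
      using d by (simp add: has_directional_derivative_def F_def G_def)
  qed simp
  then show "d \<le> a - v \<bullet> E + \<epsilon>"
    by simp
qed

text \<open>
  A half-space of which \<open>x\<close> is an interior point contains a neighbourhood of \<open>x\<close>; any other one has
  both \<open>x\<close> and \<open>y\<close> on its boundary, and hence the whole line through them.
\<close>

lemma polyhedron_prolong_segment:
  fixes x y :: "real ^ 'n"
  assumes F: "finite F" "\<And>h. h \<in> F \<Longrightarrow> \<exists>a b. a \<noteq> 0 \<and> h = {z. a \<bullet> z \<le> b}"
    and xy: "x \<in> \<Inter>F" "y \<in> \<Inter>F"
    and same: "{h \<in> F. x \<in> interior h} = {h \<in> F. y \<in> interior h}"
  obtains \<delta> where "\<delta> > 0" "x - \<delta> *\<^sub>R (y - x) \<in> \<Inter>F"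
proof -
  have "\<forall>\<^sub>F \<delta> in at_right 0. x - \<delta> *\<^sub>R (y - x) \<in> h" if h: "h \<in> F" for h
  proof -
    obtain a b where ab: "a \<noteq> 0" "h = {z. a \<bullet> z \<le> b}"
      using F(2)[OF h] by blast
    have int: "interior h = {z. a \<bullet> z < b}"
      using ab by (simp add: interior_halfspace_le)
    show ?thesis
    proof (cases "x \<in> interior h")
      case True
      have "((\<lambda>\<delta>. x - \<delta> *\<^sub>R (y - x)) \<longlongrightarrow> x - 0 *\<^sub>R (y - x)) (at_right (0::real))"
        by (intro tendsto_intros)
      then have "\<forall>\<^sub>F \<delta> in at_right 0. x - \<delta> *\<^sub>R (y - x) \<in> interior h"
        using True topological_tendstoD[of _ x _ "interior h"] by simp
      then show ?thesis
        by eventually_elim (use interior_subset in blast)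
    next
      case False
      then have "y \<notin> interior h"
        using same h by blast
      then have "a \<bullet> x = b" "a \<bullet> y = b"
        using False xy h ab int by force+
      then show ?thesis
        by (simp add: ab inner_diff_right)
    qed
  qed
  then have "\<forall>\<^sub>F \<delta> in at_right 0. \<forall>h\<in>F. x - \<delta> *\<^sub>R (y - x) \<in> h"
    using F(1) by (simp add: eventually_ball_finite)
  then have "\<forall>\<^sub>F \<delta> in at_right 0. 0 < \<delta> \<and> x - \<delta> *\<^sub>R (y - x) \<in> \<Inter>F"
    using eventually_at_right_less[of 0] by eventually_elim blast
  then obtain \<delta> where "0 < \<delta> \<and> x - \<delta> *\<^sub>R (y - x) \<in> \<Inter>F"
    using eventually_happens'[OF trivial_limit_at_right_real] by blast
  with that show thesis
    by blast
qed

text \<open>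
  The gradients of two functions active at both endpoints differ there by the same constant vector,
  while the functions themselves agree there; the trapezoidal rule makes that vector orthogonal to the
  segment.
\<close>

lemma common_gradient_set_equal_slopes:
  fixes f :: "nat \<Rightarrow> real ^ 'n \<Rightarrow> real"
  assumes quad: "\<And>i. i \<in> {1..k} \<Longrightarrow> quadratic_function (f i)"
    and xy: "x \<in> common_gradient_set X k f c" "y \<in> common_gradient_set X k f c"
    and same: "argmax_indices k f x = argmax_indices k f y"
    and active: "i \<in> argmax_indices k f x" "l \<in> argmax_indices k f x"
  shows "(y - x) \<bullet> gradient (f i) x = (y - x) \<bullet> gradient (f l) x"
proof -
  have "gradient (f i) x + c i = gradient (f l) x + c l"
    using xy(1) active unfolding common_gradient_set_def by force
  moreover have "gradient (f i) y + c i = gradient (f l) y + c l"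
    using xy(2) active same unfolding common_gradient_set_def by force
  ultimately have grad: "gradient (f i) x - gradient (f l) x = c l - c i"
    "gradient (f i) y - gradient (f l) y = c l - c i"
    by (simp_all add: algebra_simps)
  have il: "i \<in> {1..k}" "l \<in> {1..k}" and val: "f i x = f l x" "f i y = f l y"
    using active active[unfolded same] by (simp_all add: argmax_indices_Max)
  have "0 = 2 * (f i y - f i x) - 2 * (f l y - f l x)"
    unfolding val by simp
  also have "\<dots> = (y - x) \<bullet> (gradient (f i) x - gradient (f l) x)
      + (y - x) \<bullet> (gradient (f i) y - gradient (f l) y)"
    using il by (simp only: quadratic_function_trapezoidal[OF quad] inner_add_right inner_diff_right)
  also have "\<dots> = 2 * ((y - x) \<bullet> (gradient (f i) x - gradient (f l) x))"
    by (simp add: grad)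
  finally show ?thesis
    by (simp add: inner_diff_right)
qed

text \<open>
  The slope of \<open>f i - g j\<close> at \<open>x\<close> is nonnegative towards \<open>y\<close> and towards a point of \<open>X\<close> on the other
  side of \<open>x\<close>, which lies in the opposite direction.
\<close>

lemma d_stationary_slope_eq:
  fixes f g :: "nat \<Rightarrow> real ^ 'n \<Rightarrow> real" and k1 k2 :: nat
  defines "\<phi> \<equiv> \<lambda>x. (MAX i\<in>{1..k1}. f i x) - (MAX i\<in>{1..k2}. g i x)"
  assumes k1: "k1 \<ge> 1"
    and f: "\<And>i. i \<in> {1..k1} \<Longrightarrow> quadratic_function (f i)"
    and g: "\<And>i. i \<in> {1..k2} \<Longrightarrow> quadratic_function (g i)"
    and x: "x \<in> common_gradient_set X k1 f c" "x \<in> d_stationary_points \<phi> X"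
    and y: "y \<in> common_gradient_set X k1 f c"
    and same: "argmax_indices k1 f x = argmax_indices k1 f y"
    and i: "i \<in> argmax_indices k1 f x" and j: "j \<in> argmax_indices k2 g x"
    and \<delta>: "\<delta> > 0" "x - \<delta> *\<^sub>R (y - x) \<in> X"
  shows "(y - x) \<bullet> gradient (f i) x = (y - x) \<bullet> gradient (g j) x"
proof -
  \<comment> \<open>Allowing a scalar multiple of \<open>y - x\<close> covers both directions at once.\<close>
  have *: "t * ((y - x) \<bullet> gradient (g j) x) \<le> t * ((y - x) \<bullet> gradient (f i) x)"
    if t: "x + t *\<^sub>R (y - x) \<in> X" for t
  proof -
    obtain d where d: "has_directional_derivative \<phi> x (t *\<^sub>R (y - x)) d" "d \<ge> 0"
      using x(2) t unfolding d_stationary_points_def by force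
    have "d \<le> t * ((y - x) \<bullet> gradient (f i) x) - t *\<^sub>R (y - x) \<bullet> gradient (g j) x"
    proof (rule directional_derivative_diff_Max_le)
      show "k1 \<ge> 1" by fact
      show "GDERIV (f l) x :> gradient (f l) x" if "l \<in> {1..k1}" for l
        using that by (intro quadratic_function_GDERIV f)
      show "GDERIV (g j) x :> gradient (g j) x"
        using j by (intro quadratic_function_GDERIV g) (simp add: argmax_indices_Max)
      show "j \<in> argmax_indices k2 g x" by fact
      show "t *\<^sub>R (y - x) \<bullet> gradient (f l) x \<le> t * ((y - x) \<bullet> gradient (f i) x)"
        if "l \<in> argmax_indices k1 f x" for l
        using common_gradient_set_equal_slopes[OF f x(1) y same that i] by simp
      show "has_directional_derivative
          (\<lambda>x. (MAX i\<in>{1..k1}. f i x) - (MAX i\<in>{1..k2}. g i x)) x (t *\<^sub>R (y - x)) d"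
        using d(1) by (simp add: \<phi>_def)
    qed
    with d(2) show ?thesis by simp
  qed
  have "y \<in> X"
    using y by (simp add: common_gradient_set_def)
  then show ?thesis
    using *[of 1] *[of "- \<delta>"] \<delta> by simp
qed

theorem proposition4:
  fixes X :: "(real ^ 'n) set"
    and k1 k2 :: nat
    and \<psi>1 \<psi>2 :: "nat \<Rightarrow> real ^ 'n \<Rightarrow> real"
    and \<psi> :: "real ^ 'n \<Rightarrow> real"
    and c :: "nat \<Rightarrow> real ^ 'n"
  assumes "polyhedron X"
    and "k1 \<ge> 1" and "k2 \<ge> 1"
    and "\<And>i. i \<in> {1..k1} \<Longrightarrow> quadratic_function (\<psi>1 i)"
    and "\<And>i. i \<in> {1..k2} \<Longrightarrow> quadratic_function (\<psi>2 i)"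
    and "\<And>x. \<psi> x = (MAX i\<in>{1..k1}. \<psi>1 i x) - (MAX i\<in>{1..k2}. \<psi>2 i x)"
  shows "finite (\<psi> ` (common_gradient_set X k1 \<psi>1 c \<inter> d_stationary_points \<psi> X))"
proof -
  obtain F where F: "finite F" "X = \<Inter>F"
      "\<And>h. h \<in> F \<Longrightarrow> \<exists>a b. a \<noteq> 0 \<and> h = {z. a \<bullet> z \<le> b}"
    using assms(1) unfolding polyhedron_def by blast
  have \<psi>: "\<psi> = (\<lambda>x. (MAX i\<in>{1..k1}. \<psi>1 i x) - (MAX i\<in>{1..k2}. \<psi>2 i x))"
    by (rule ext) (rule assms(6))
  define S where "S = common_gradient_set X k1 \<psi>1 c \<inter> d_stationary_points \<psi> X"
  define data where "data = (\<lambda>x. (argmax_indices k1 \<psi>1 x, argmax_indices k2 \<psi>2 x,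
      {h \<in> F. x \<in> interior h}))"
  have slope: "(y - x) \<bullet> gradient (\<psi>1 i) x = (y - x) \<bullet> gradient (\<psi>2 j) x"
    if xy: "x \<in> S" "y \<in> S" "data x = data y"
      and ij: "i \<in> argmax_indices k1 \<psi>1 x" "j \<in> argmax_indices k2 \<psi>2 x" for x y i j
  proof -
    have "x \<in> \<Inter>F" "y \<in> \<Inter>F"
      using xy F(2) by (auto simp: S_def common_gradient_set_def)
    then obtain \<delta> where \<delta>: "\<delta> > 0" "x - \<delta> *\<^sub>R (y - x) \<in> X"
      using polyhedron_prolong_segment[OF F(1,3)] xy(3) F(2) unfolding data_def
      by (metis (no_types, lifting) prod.inject)
    show ?thesis
      by (rule d_stationary_slope_eq[where f = \<psi>1 and g = \<psi>2 and ?k1.0 = k1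
            and ?k2.0 = k2 and c = c, folded \<psi>, OF assms(2,4,5) _ _ _ _ ij \<delta>])
         (use xy in \<open>simp_all add: S_def data_def\<close>)
  qed
  have "\<psi> x = \<psi> y" if xy: "x \<in> S" "y \<in> S" "data x = data y" for x y
  proof -
    obtain i j where ij: "i \<in> argmax_indices k1 \<psi>1 x" "j \<in> argmax_indices k2 \<psi>2 x"
      using argmax_indices_nonempty assms(2,3) by (metis ex_in_conv)
    then have ij': "i \<in> argmax_indices k1 \<psi>1 y" "j \<in> argmax_indices k2 \<psi>2 y"
      using xy(3) by (simp_all add: data_def)
    have quad: "quadratic_function (\<psi>1 i)" "quadratic_function (\<psi>2 j)"
      using ij assms(4,5) by (auto simp: argmax_indices_Max)
    have sx: "(y - x) \<bullet> gradient (\<psi>1 i) x = (y - x) \<bullet> gradient (\<psi>2 j) x"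
      using slope[OF xy ij] .
    have "(x - y) \<bullet> gradient (\<psi>1 i) y = (x - y) \<bullet> gradient (\<psi>2 j) y"
      using slope[OF xy(2,1) xy(3)[symmetric] ij'] .
    then have sy: "(y - x) \<bullet> gradient (\<psi>1 i) y = (y - x) \<bullet> gradient (\<psi>2 j) y"
      by (simp add: inner_diff_left)
    have "\<psi>1 i y - \<psi>1 i x = \<psi>2 j y - \<psi>2 j x"
      using quad[THEN quadratic_function_trapezoidal, of y x] sx sy
      by (simp add: inner_add_right)
    moreover have "\<psi> x = \<psi>1 i x - \<psi>2 j x" "\<psi> y = \<psi>1 i y - \<psi>2 j y"
      using ij ij' by (simp_all add: \<psi> argmax_indices_Max)
    ultimately show ?thesis
      by simp
  qed
  moreover have "finite (data ` S)"
  proof (rule finite_subset)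
    show "data ` S \<subseteq> Pow {1..k1} \<times> Pow {1..k2} \<times> Pow F"
      by (auto simp: data_def argmax_indices_Max)
  qed (use F(1) in simp)
  ultimately show ?thesis
    unfolding S_def[symmetric] by (intro finite_image_if_factors[of data S \<psi>])
qed

end
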